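(* Let $X$ be a separable F-space equipped with a translation-invariant metric $d$ generating its topology, let $T:X\to X$ be a continuous linear operator, and let $\delta>0$. If $T$ satisfies the $\delta$-Hypercyclicity Criterion, then $T$ is $\delta$-hypercyclic.
   Context: An F-space is a topological vector space (over $\mathbb R$ or $\mathbb C$) whose topology is induced by a complete translation-invariant metric. For $A\subset X$ and $r>0$, $B_r(A):=\{x\in X:\inf_{y\in A}d(x,y)<r\}$. $\delta$-Hypercyclicity Criterion: Let $X$ be a separable topological vector space equipped with a translation-invariant metric $d$ generating its topology, $T:X\to X$ a continuous linear operator, and $\delta>0$. $T$ satisfies the $\delta$-Hypercyclicity Criterion if there exist a strictly increasing sequence $(n_k)$ of (nonnegative) integers, dense subsets $V,W\subset X$, and maps $S_{n_k}:W\to X$ (not assumed linear or continuous) such that: (1) for every $v\in V$, $T^{n_k}v\to0$; (2) for every $w\in W$, $S_{n_k}w\to0$; (3) for every $w\in W$ there exists $k_0\in\mathbb N$ such that $d(T^{n_k}(S_{n_k}w),w)<\delta$ for all $k\ge k_0$. $T$ is $\delta$-hypercyclic if there exists $x\in X$ whose forward orbit $\{T^nx:n\ge0\}$ is $\delta$-dense in $X$, meaning that for every nonempty open set $O\subset X$ there exists $n\ge0$ with $T^nx\in B_\delta(O)$ (equivalently $\inf_{n\ge0}\operatorname{dist}(T^nx,O)<\delta$). *)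

theory Defs
  imports "HOL-Analysis.Analysis"
begin

(* Up to isomorphism the instances of real_normed_field are exactly the fields of real and of
   complex numbers (Gelfand-Mazur), so an arbitrary scalar field of this class means "over R or C".
   Joint continuity of addition is part of the class topological_ab_group_add. *)
locale topological_vector_space = vector_space scale
  for scale :: "'k::real_normed_field \<Rightarrow> 'a::topological_ab_group_add \<Rightarrow> 'a" +
  assumes continuous_on_scale: "continuous_on UNIV (\<lambda>(c, x). scale c x)"

definition invariant_metric :: "('a::topological_ab_group_add \<Rightarrow> 'a \<Rightarrow> real) \<Rightarrow> bool" where
  "invariant_metric d \<longleftrightarrow>
     Metric_space UNIV d \<and>
     Metric_space.mtopology UNIV d = euclidean \<and>
     (\<forall>x y z. d (x + z) (y + z) = d x y)"

locale F_space = topological_vector_space scale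
  for scale :: "'k::real_normed_field \<Rightarrow> 'a::topological_ab_group_add \<Rightarrow> 'a" +
  assumes complete_invariant_metric:
    "\<exists>d :: 'a \<Rightarrow> 'a \<Rightarrow> real. invariant_metric d \<and> Metric_space.mcomplete UNIV d"

(* Only meaningful for nonempty A: the library leaves the infimum of the empty set of reals unspecified. *)
definition metric_nhd :: "('a \<Rightarrow> 'a \<Rightarrow> real) \<Rightarrow> real \<Rightarrow> 'a set \<Rightarrow> 'a set" where
  "metric_nhd d r A = {x. (INF y\<in>A. d x y) < r}"

(* S m is the map written S_m in the literature. Only the S (n k) restricted to W matter. *)
definition delta_hypercyclicity_criterion ::
    "('a::topological_ab_group_add \<Rightarrow> 'a \<Rightarrow> real) \<Rightarrow> real \<Rightarrow> ('a \<Rightarrow> 'a) \<Rightarrow> bool" where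
  "delta_hypercyclicity_criterion d \<delta> T \<longleftrightarrow>
     (\<exists>(n :: nat \<Rightarrow> nat) V W (S :: nat \<Rightarrow> 'a \<Rightarrow> 'a).
        strict_mono n \<and> closure V = UNIV \<and> closure W = UNIV \<and>
        (\<forall>v\<in>V. (\<lambda>k. (T ^^ n k) v) \<longlonglongrightarrow> 0) \<and>
        (\<forall>w\<in>W. (\<lambda>k. S (n k) w) \<longlonglongrightarrow> 0) \<and>
        (\<forall>w\<in>W. \<exists>k0. \<forall>k\<ge>k0. d ((T ^^ n k) (S (n k) w)) w < \<delta>))"

definition delta_dense ::
    "('a::topological_space \<Rightarrow> 'a \<Rightarrow> real) \<Rightarrow> real \<Rightarrow> 'a set \<Rightarrow> bool" where
  "delta_dense d \<delta> D \<longleftrightarrow> (\<forall>U. open U \<and> U \<noteq> {} \<longrightarrow> (\<exists>y\<in>D. y \<in> metric_nhd d \<delta> U))"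

definition delta_hypercyclic ::
    "('a::topological_space \<Rightarrow> 'a \<Rightarrow> real) \<Rightarrow> real \<Rightarrow> ('a \<Rightarrow> 'a) \<Rightarrow> bool" where
  "delta_hypercyclic d \<delta> T \<longleftrightarrow> (\<exists>x. delta_dense d \<delta> (range (\<lambda>n. (T ^^ n) x)))"

end

theory Submission
  imports Defs
begin

text \<open>
  The theorem follows from a \<open>\<delta>\<close>-version of Birkhoff's transitivity theorem. Call \<open>T\<close>
  \<open>\<delta>\<close>-transitive if for all nonempty open \<open>U\<close> and \<open>O\<close> some iterate \<open>T\<^sup>n\<close> sends a point of \<open>U\<close>
  into \<open>B\<^sub>\<delta>(O)\<close>.

  The criterion implies \<open>\<delta>\<close>-transitivity (\<open>criterion_imp_delta_transitive\<close>): take \<open>v \<in> V \<inter> U\<close>,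
  \<open>w \<in> W \<inter> O\<close>, and put \<open>x\<^sub>k = v + S\<^bsub>n k\<^esub> w\<close>, which tends to \<open>v\<close> and so is eventually in \<open>U\<close>.
  The triangle inequality bounds the distance of \<open>T\<^bsup>n k\<^esup> x\<^sub>k\<close> to \<open>w\<close> only by \<open>\<delta>\<close> plus a null
  sequence, which does not suffice. Instead, \<open>T\<^bsup>n k\<^esup> x\<^sub>k\<close> is compared with
  \<open>w\<^sub>k = w + T\<^bsup>n k\<^esup> v\<close>, which is eventually in the open set \<open>O\<close>; by linearity and translation
  invariance the distance is exactly that of \<open>T\<^bsup>n k\<^esup> (S\<^bsub>n k\<^esub> w)\<close> to \<open>w\<close>, hence eventually
  less than \<open>\<delta>\<close>.

  In turn, on a second countable completely metrizable space a \<open>\<delta>\<close>-transitive continuous map is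
  \<open>\<delta>\<close>-hypercyclic (\<open>delta_transitive_imp_delta_hypercyclic\<close>): for each nonempty member \<open>O\<close> of a
  countable base, the points whose orbit meets \<open>B\<^sub>\<delta>(O)\<close> form a dense open set, and a point in the
  intersection of these sets, which exists by the Baire category theorem, has a \<open>\<delta>\<close>-dense orbit.
  The metric \<open>d\<close> itself need not be known to be complete, since complete metrizability is a property of the topology alone.
\<close>

text \<open>\<open>\<delta>\<close>-transitivity: every nonempty open set is sent by some iterate of \<open>T\<close> to a set meeting
  the \<open>\<delta>\<close>-neighbourhood of any given nonempty open set.\<close>

definition delta_transitive ::
    "('a::topological_space \<Rightarrow> 'a \<Rightarrow> real) \<Rightarrow> real \<Rightarrow> ('a \<Rightarrow> 'a) \<Rightarrow> bool" where
  "delta_transitive d \<delta> T \<longleftrightarrow>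
     (\<forall>U G. open U \<and> U \<noteq> {} \<and> open G \<and> G \<noteq> {} \<longrightarrow>
        (\<exists>n. \<exists>x\<in>U. (T ^^ n) x \<in> metric_nhd d \<delta> G))"

lemma mem_metric_nhd_iff:
  assumes "Metric_space UNIV d" and "A \<noteq> {}"
  shows "x \<in> metric_nhd d r A \<longleftrightarrow> (\<exists>y\<in>A. d x y < r)"
proof -
  interpret Metric_space UNIV d by fact
  have "bdd_below (d x ` A)"
    by (rule bdd_belowI[of _ 0]) auto
  then show ?thesis
    using assms(2) by (simp add: metric_nhd_def cINF_less_iff)
qed

lemma open_metric_nhd:
  fixes d :: "'a::topological_space \<Rightarrow> 'a \<Rightarrow> real"
  assumes "Metric_space UNIV d" and "Metric_space.mtopology UNIV d = euclidean" and "A \<noteq> {}"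
  shows "open (metric_nhd d r A)"
proof -
  interpret Metric_space UNIV d by fact
  have "metric_nhd d r A = (\<Union>y\<in>A. mball y r)"
    using mem_metric_nhd_iff[OF assms(1,3)] by (auto simp: commute)
  moreover have "open (mball y r)" for y
    using openin_mball[of y r] assms(2) by simp
  ultimately show ?thesis
    by auto
qed

lemma continuous_on_funpow:
  fixes f :: "'a::topological_space \<Rightarrow> 'a"
  assumes "continuous_on UNIV f"
  shows "continuous_on UNIV (f ^^ n)"
proof (induction n)
  case (Suc n)
  then have "continuous_on UNIV (f \<circ> (f ^^ n))"
    by (intro continuous_on_compose continuous_on_subset[OF assms]) auto
  then show ?case by simp
qed (simp add: id_def)

lemma (in Metric_space) separable_imp_second_countable:
  assumes "separable_space mtopology"
  shows "second_countable mtopology"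
proof -
  obtain C where C: "countable C" "C \<subseteq> M" "mtopology closure_of C = M"
    using assms by (auto simp: separable_space_def)
  define \<B> where "\<B> = (\<lambda>(c, m). mball c (1 / real (Suc m))) ` (C \<times> (UNIV :: nat set))"
  have "\<exists>B\<in>\<B>. x \<in> B \<and> B \<subseteq> U" if U: "openin mtopology U" "x \<in> U" for U x
  proof -
    obtain r where r: "r > 0" "mball x r \<subseteq> U" and "x \<in> M"
      using U unfolding openin_mtopology by blast
    obtain m where m: "1 / real (Suc m) < r / 2"
      using nat_approx_posE[of "r / 2"] r by auto
    have "x \<in> mtopology closure_of C"
      using C \<open>x \<in> M\<close> by simp
    then have "\<forall>r>0. \<exists>c\<in>C. c \<in> mball x r"
      by (simp add: metric_closure_of)
    moreover have "0 < 1 / real (Suc m)"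
      by simp
    ultimately obtain c where c: "c \<in> C" "c \<in> mball x (1 / real (Suc m))"
      by blast
    have "mball c (1 / real (Suc m)) \<subseteq> mball x r"
      using c m by (intro mball_subset) (auto simp: commute)
    moreover have "x \<in> mball c (1 / real (Suc m))"
      using c by (simp add: commute)
    moreover have "mball c (1 / real (Suc m)) \<in> \<B>"
      unfolding \<B>_def by (rule image_eqI[of _ _ "(c, m)"]) (use c(1) in auto)
    ultimately show ?thesis
      using r(2) by (meson subset_trans)
  qed
  moreover have "countable \<B>"
    using C(1) unfolding \<B>_def by auto
  moreover have "\<forall>B\<in>\<B>. openin mtopology B"
    by (auto simp: \<B>_def)
  ultimately show ?thesis
    unfolding second_countable_def by blast
qed

text \<open>The \<open>\<delta>\<close>-version of Birkhoff's transitivity theorem.\<close>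

lemma delta_transitive_imp_delta_hypercyclic:
  fixes T :: "'a::topological_space \<Rightarrow> 'a"
  assumes d: "Metric_space UNIV d" "Metric_space.mtopology UNIV d = euclidean"
    and complete: "completely_metrizable_space (euclidean :: 'a topology)"
    and countable: "second_countable (euclidean :: 'a topology)"
    and cont: "continuous_on UNIV T"
    and trans: "delta_transitive d \<delta> T"
  shows "delta_hypercyclic d \<delta> T"
proof -
  obtain \<B> :: "'a set set" where \<B>: "countable \<B>" "\<And>B. B \<in> \<B> \<Longrightarrow> open B"
    "\<And>U x. open U \<Longrightarrow> x \<in> U \<Longrightarrow> \<exists>B\<in>\<B>. x \<in> B \<and> B \<subseteq> U"
    using countable unfolding second_countable_def by auto
  define G where "G = (\<lambda>B. \<Union>n. (T ^^ n) -` metric_nhd d \<delta> B)"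
  have "open (G B) \<and> closure (G B) = UNIV" if "B \<in> \<B> - {{}}" for B
  proof
    have "open (metric_nhd d \<delta> B)"
      using that by (intro open_metric_nhd[OF d]) simp
    then show "open (G B)"
      unfolding G_def by (intro open_UN ballI open_vimage continuous_on_funpow[OF cont])
    have "U \<inter> G B \<noteq> {}" if U: "open U" "U \<noteq> {}" for U
    proof -
      have "open B" "B \<noteq> {}"
        using \<open>B \<in> \<B> - {{}}\<close> \<B>(2) by auto
      then obtain n x where "x \<in> U" "(T ^^ n) x \<in> metric_nhd d \<delta> B"
        using trans U unfolding delta_transitive_def by metis
      then show ?thesis
        unfolding G_def by auto
    qed
    from this[of "- closure (G B)"] show "closure (G B) = UNIV"
      using closure_subset[of "G B"] by auto
  qed
  then have "euclidean closure_of (\<Inter> (G ` (\<B> - {{}}))) = topspace euclidean"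
    using \<B>(1) complete by (intro Baire_category) auto
  then have "closure (\<Inter> (G ` (\<B> - {{}}))) = UNIV"
    by simp
  then obtain x where x: "x \<in> \<Inter> (G ` (\<B> - {{}}))"
    by (metis UNIV_not_empty closure_empty ex_in_conv)
  have "\<exists>n. (T ^^ n) x \<in> metric_nhd d \<delta> U" if "open U" "U \<noteq> {}" for U
  proof -
    obtain B where B: "B \<in> \<B>" "B \<noteq> {}" "B \<subseteq> U"
      using \<B>(3) \<open>open U\<close> \<open>U \<noteq> {}\<close> by blast
    then obtain n where "(T ^^ n) x \<in> metric_nhd d \<delta> B"
      using x unfolding G_def by auto
    then have "(T ^^ n) x \<in> metric_nhd d \<delta> U"
      using B \<open>U \<noteq> {}\<close> by (auto simp: mem_metric_nhd_iff[OF d(1)])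
    then show ?thesis ..
  qed
  then show ?thesis
    unfolding delta_hypercyclic_def delta_dense_def by (intro exI[of _ x]) auto
qed

lemma criterion_imp_delta_transitive:
  fixes T :: "'a::topological_ab_group_add \<Rightarrow> 'a"
  assumes d: "invariant_metric d"
    and add: "\<And>x y. T (x + y) = T x + T y"
    and crit: "delta_hypercyclicity_criterion d \<delta> T"
  shows "delta_transitive d \<delta> T"
proof -
  have metric: "Metric_space UNIV d" and inv: "\<And>x y z. d (x + z) (y + z) = d x y"
    using d by (auto simp: invariant_metric_def)
  have add_funpow: "(T ^^ m) (x + y) = (T ^^ m) x + (T ^^ m) y" for m x y
    by (induction m) (auto simp: add)
  obtain n V W S where VW: "closure V = UNIV" "closure W = UNIV"
    and V: "\<And>v. v \<in> V \<Longrightarrow> (\<lambda>k. (T ^^ n k) v) \<longlonglongrightarrow> 0"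
    and W: "\<And>w. w \<in> W \<Longrightarrow> (\<lambda>k. S (n k) w) \<longlonglongrightarrow> 0"
    and TS: "\<And>w. w \<in> W \<Longrightarrow> \<exists>k0. \<forall>k\<ge>k0. d ((T ^^ n k) (S (n k) w)) w < \<delta>"
    using crit unfolding delta_hypercyclicity_criterion_def by metis
  have "\<exists>m. \<exists>x\<in>U. (T ^^ m) x \<in> metric_nhd d \<delta> G"
    if UG: "open U" "U \<noteq> {}" "open G" "G \<noteq> {}" for U G
  proof -
    obtain v w where v: "v \<in> V" "v \<in> U" and w: "w \<in> W" "w \<in> G"
      using UG VW open_Int_closure_eq_empty[of U V] open_Int_closure_eq_empty[of G W] by auto
    have "(\<lambda>k. v + S (n k) w) \<longlonglongrightarrow> v"
      using tendsto_add[OF tendsto_const[of v] W[OF w(1)]] by simp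
    then have "\<forall>\<^sub>F k in sequentially. v + S (n k) w \<in> U"
      using UG(1) v(2) by (rule topological_tendstoD)
    moreover have "(\<lambda>k. w + (T ^^ n k) v) \<longlonglongrightarrow> w"
      using tendsto_add[OF tendsto_const[of w] V[OF v(1)]] by simp
    then have "\<forall>\<^sub>F k in sequentially. w + (T ^^ n k) v \<in> G"
      using UG(3) w(2) by (rule topological_tendstoD)
    moreover have "\<forall>\<^sub>F k in sequentially. d ((T ^^ n k) (S (n k) w)) w < \<delta>"
      using TS[OF w(1)] by (simp add: eventually_sequentially)
    ultimately have "\<forall>\<^sub>F k in sequentially. v + S (n k) w \<in> U \<and> w + (T ^^ n k) v \<in> G \<and>
        d ((T ^^ n k) (S (n k) w)) w < \<delta>"
      by (simp add: eventually_conj_iff)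
    then obtain k where k: "v + S (n k) w \<in> U" "w + (T ^^ n k) v \<in> G"
        "d ((T ^^ n k) (S (n k) w)) w < \<delta>"
      using eventually_happens'[OF sequentially_bot] by blast
    \<comment> \<open>Both points are translated by \<open>T\<^bsup>n k\<^esup> v\<close>.\<close>
    have "d ((T ^^ n k) (v + S (n k) w)) (w + (T ^^ n k) v) < \<delta>"
      using k(3) inv[of "(T ^^ n k) (S (n k) w)" "(T ^^ n k) v" w]
      by (simp add: add_funpow add.commute[of "(T ^^ n k) v"])
    then have "(T ^^ n k) (v + S (n k) w) \<in> metric_nhd d \<delta> G"
      using k(2) UG(4) by (auto simp: mem_metric_nhd_iff[OF metric])
    then show ?thesis
      using k(1) by blast
  qed
  then show ?thesis
    unfolding delta_transitive_def by blast
qed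

theorem proposition3p3:
  fixes scale :: "'k::real_normed_field \<Rightarrow> 'a::topological_ab_group_add \<Rightarrow> 'a"
    and d :: "'a \<Rightarrow> 'a \<Rightarrow> real"
    and T :: "'a \<Rightarrow> 'a"
    and \<delta> :: real
  assumes "F_space scale"
    and "separable_space (euclidean :: 'a topology)"
    and "invariant_metric d"
    and "Vector_Spaces.linear scale scale T"
    and "continuous_on UNIV T"
    and "\<delta> > 0"
    and "delta_hypercyclicity_criterion d \<delta> T"
  shows "delta_hypercyclic d \<delta> T"
proof -
  have d: "Metric_space UNIV d" "Metric_space.mtopology UNIV d = euclidean"
    using assms(3) by (auto simp: invariant_metric_def)
  obtain d' :: "'a \<Rightarrow> 'a \<Rightarrow> real"
    where "invariant_metric d'" "Metric_space.mcomplete UNIV d'"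
    using F_space.complete_invariant_metric[OF assms(1)] by blast
  then have "completely_metrizable_space (euclidean :: 'a topology)"
    unfolding completely_metrizable_space_def invariant_metric_def by metis
  moreover have "second_countable (euclidean :: 'a topology)"
    using Metric_space.separable_imp_second_countable[OF d(1)] assms(2) d(2) by simp
  moreover have "T (x + y) = T x + T y" for x y
    using module_hom.add[OF Vector_Spaces.linear.axioms(3)[OF assms(4)]] .
  then have "delta_transitive d \<delta> T"
    by (rule criterion_imp_delta_transitive[OF assms(3) _ assms(7)])
  ultimately show ?thesis
    by (rule delta_transitive_imp_delta_hypercyclic[OF d _ _ assms(5)])
qed

end
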